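(* Let $A$ be an $m\times n$ real matrix, $b\in\mathbb{R}^m$, $p\in\mathbb{R}^n$, and let $X=\{x\in\mathbb{R}^n\mid Ax=b,\ x\geq 0\}$ be nonempty. Let $X^*$ be the set of basic solutions in $X$, let $Y$ be the set of optimal solutions of the problem $$\text{Maximize } p^T x \text{ subject to } Ax=b,\ x\geq 0,$$ assume that $Y$ is nonempty, and let $Y^*=Y\cap X^*$. Suppose $X$ is bounded. Then $$Y=\Big\{\sum_{y^*\in Y^*}\alpha_{y^*}y^* \ \Big|\ \alpha_{y^*}\geq 0 \text{ for all } y^*\in Y^* \text{ and } \sum_{y^*\in Y^*}\alpha_{y^*}=1\Big\},$$ and $Y^*$ is the set of extreme points of $Y$.
   Context: For a vector $x$, $x\geq 0$ means that every coordinate of $x$ is nonnegative. $A^j$ denotes the $j$-th column of $A$. The set of basic solutions is $X^*=\{x\in X\mid \text{the columns of } A \text{ in the array } \langle A^j\mid x_j>0\rangle \text{ are linearly independent}\}$, where linear independence is that of the family indexed by $\{j\mid x_j>0\}$; if $0\in X$, then $0$ counts as a basic solution. The set $X^*$ is finite, so $Y^*$ is finite. Elements of $Y^*$ are called basic optimal solutions. A point $y\in Y$ is an extreme point of $Y$ if there do not exist distinct $y^{(1)},y^{(2)}\in Y$ and $\alpha\in(0,1)$ such that $y=\alpha y^{(1)}+(1-\alpha)y^{(2)}$. *)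

theory Defs
  imports "HOL-Analysis.Analysis"
begin

definition feasible_set :: "real ^ 'n ^ 'm \<Rightarrow> real ^ 'm \<Rightarrow> (real ^ 'n) set" where
  "feasible_set A b = {x. A *v x = b \<and> (\<forall>j. 0 \<le> x $ j)}"

(* Linear independence of the family of columns indexed by J: since "independent" is a
   predicate on sets, injectivity on J is needed to exclude repeated columns. *)
definition independent_columns :: "real ^ 'n ^ 'm \<Rightarrow> 'n set \<Rightarrow> bool" where
  "independent_columns A J \<longleftrightarrow>
     inj_on (\<lambda>j. column j A) J \<and> independent ((\<lambda>j. column j A) ` J)"

lemma independent_columns_iff:
  fixes A :: "real ^ 'n ^ 'm"
  shows "independent_columns A J \<longleftrightarrow>
    (\<forall>c. (\<Sum>j\<in>J. c j *\<^sub>R column j A) = 0 \<longrightarrow> (\<forall>j\<in>J. c j = 0))"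
proof
  assume L: "independent_columns A J"
  show "\<forall>c. (\<Sum>j\<in>J. c j *\<^sub>R column j A) = 0 \<longrightarrow> (\<forall>j\<in>J. c j = 0)"
  proof (intro allI impI ballI)
    fix c j
    assume s: "(\<Sum>j\<in>J. c j *\<^sub>R column j A) = 0" and j: "j \<in> J"
    let ?f = "\<lambda>j. column j A"
    have inj: "inj_on ?f J" and ind: "independent (?f ` J)"
      using L by (auto simp: independent_columns_def)
    have "(\<Sum>v\<in>?f ` J. c (the_inv_into J ?f v) *\<^sub>R v) = (\<Sum>j\<in>J. c j *\<^sub>R ?f j)"
      by (simp add: sum.reindex[OF inj] the_inv_into_f_f[OF inj])
    with s have "(\<Sum>v\<in>?f ` J. c (the_inv_into J ?f v) *\<^sub>R v) = 0" by simp
    with ind have "c (the_inv_into J ?f (?f j)) = 0"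
      using j by (auto simp: independent_explicit)
    then show "c j = 0" by (simp add: the_inv_into_f_f[OF inj j])
  qed
next
  assume R: "\<forall>c. (\<Sum>j\<in>J. c j *\<^sub>R column j A) = 0 \<longrightarrow> (\<forall>j\<in>J. c j = 0)"
  let ?f = "\<lambda>j. column j A"
  have inj: "inj_on ?f J"
  proof (rule inj_onI, rule ccontr)
    fix i j assume ij: "i \<in> J" "j \<in> J" "?f i = ?f j" "i \<noteq> j"
    let ?c = "\<lambda>k. (if k = i then 1 else 0) - (if k = j then 1 else (0::real))"
    have "(\<Sum>k\<in>J. ?c k *\<^sub>R ?f k) =
        (\<Sum>k\<in>J. if k = i then ?f k else 0) - (\<Sum>k\<in>J. if k = j then ?f k else 0)"
      unfolding sum_subtractf[symmetric] by (rule sum.cong) auto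
    also have "\<dots> = 0" using ij by simp
    finally have "?c i = 0" using R[THEN spec, of ?c] ij(1) by blast
    then show False using ij(4) by simp
  qed
  have "independent (?f ` J)"
    unfolding independent_explicit
  proof (intro conjI allI impI ballI)
    show "finite (?f ` J)" by simp
    fix c v assume s: "(\<Sum>v\<in>?f ` J. c v *\<^sub>R v) = 0" and "v \<in> ?f ` J"
    then obtain j where j: "j \<in> J" "v = ?f j" by blast
    from s have "(\<Sum>j\<in>J. c (?f j) *\<^sub>R ?f j) = 0" by (simp add: sum.reindex[OF inj])
    from R[rule_format, OF this j(1)] j(2) show "c v = 0" by simp
  qed
  with inj show "independent_columns A J" by (simp add: independent_columns_def)
qed

definition basic_solutions :: "real ^ 'n ^ 'm \<Rightarrow> real ^ 'm \<Rightarrow> (real ^ 'n) set" where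
  "basic_solutions A b = {x \<in> feasible_set A b. independent_columns A {j. x $ j > 0}}"

definition optimal_solutions ::
    "real ^ 'n ^ 'm \<Rightarrow> real ^ 'm \<Rightarrow> real ^ 'n \<Rightarrow> (real ^ 'n) set" where
  "optimal_solutions A b p = {x \<in> feasible_set A b. \<forall>z \<in> feasible_set A b. p \<bullet> z \<le> p \<bullet> x}"

definition basic_optimal_solutions ::
    "real ^ 'n ^ 'm \<Rightarrow> real ^ 'm \<Rightarrow> real ^ 'n \<Rightarrow> (real ^ 'n) set" where
  "basic_optimal_solutions A b p = optimal_solutions A b p \<inter> basic_solutions A b"

end

theory Submission
  imports Defs
begin

text \<open>
  The feasible points whose support columns are independent are exactly the extreme points of
  the feasible polyhedron \<open>X\<close> (lemma \<open>basic_solutions_eq_extreme_points\<close>). A linear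
  dependency among the columns over the support of \<open>x\<close> gives a direction \<open>d \<noteq> 0\<close> in the kernel
  of \<open>A\<close> along which one can move a little both ways without leaving \<open>X\<close>, so that \<open>x\<close> is the
  midpoint of a segment in \<open>X\<close>. Conversely, nonnegativity forces the endpoints of a segment
  in \<open>X\<close> through \<open>x\<close> to vanish wherever \<open>x\<close> does, and independence leaves only one solution of
  the linear system that vanishes there.

  The optimal set \<open>Y\<close> is the face of \<open>X\<close> cut out by the supporting hyperplane of the objective
  (lemma \<open>optimal_solutions_face_of\<close>), and the extreme points of a face are the extreme points of
  the whole set that lie in it; hence the extreme points of \<open>Y\<close> are the basic optimal solutions.
  As \<open>X\<close> is bounded, \<open>Y\<close> is compact and convex, so Minkowski's theorem makes it the
  convex hull of its extreme points. These are finitely many, because a basic solution is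
  determined by its support, and so the hull consists of the convex combinations over the
  whole of \<open>Y\<^sup>*\<close>.
\<close>

lemma matrix_vector_mult_eq_sum_columns_on:
  fixes A :: "real ^ 'n ^ 'm"
  assumes "\<And>j. j \<notin> J \<Longrightarrow> d $ j = 0"
  shows "A *v d = (\<Sum>j\<in>J. d $ j *\<^sub>R column j A)"
proof -
  have "A *v d = (\<Sum>j\<in>UNIV. d $ j *\<^sub>R column j A)"
    by (simp add: matrix_mult_sum scalar_mult_eq_scaleR)
  also have "\<dots> = (\<Sum>j\<in>J. d $ j *\<^sub>R column j A)"
    by (rule sum.mono_neutral_right) (auto simp: assms)
  finally show ?thesis .
qed

text \<open>
  The difference \<open>u - v\<close> is supported in \<open>J\<close>, so its coordinates are the coefficients of a linear
  dependency among the columns over \<open>J\<close>. This is the one way in which independence of the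
  support columns is used, both to count the basic solutions and to show that they are extreme.
\<close>

lemma independent_columns_imp_unique_solution:
  fixes A :: "real ^ 'n ^ 'm"
  assumes "independent_columns A J" and "A *v u = A *v v"
    and "\<And>j. j \<notin> J \<Longrightarrow> u $ j = v $ j"
  shows "u = v"
proof -
  have "(\<Sum>j\<in>J. (u - v) $ j *\<^sub>R column j A) = A *v (u - v)"
    by (rule matrix_vector_mult_eq_sum_columns_on[symmetric]) (simp add: assms(3))
  also have "\<dots> = 0"
    using assms(2) by (simp add: matrix_vector_mult_diff_distrib)
  finally have "\<forall>j\<in>J. (u - v) $ j = 0"
    using assms(1) unfolding independent_columns_iff by blast
  then have "u $ j = v $ j" for j
    using assms(3)[of j] by (cases "j \<in> J") auto
  then show ?thesis by (simp add: vec_eq_iff)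
qed

text \<open>Each basic solution is determined by its support, and there are finitely many supports.\<close>

lemma finite_basic_solutions: "finite (basic_solutions A b)"
proof -
  have "inj_on (\<lambda>x. {j. x $ j > 0}) (basic_solutions A b)"
  proof (rule inj_onI)
    fix x y
    assume x: "x \<in> basic_solutions A b" and y: "y \<in> basic_solutions A b"
      and eq: "{j. x $ j > 0} = {j. y $ j > 0}"
    show "x = y"
    proof (rule independent_columns_imp_unique_solution)
      show "independent_columns A {j. x $ j > 0}" and "A *v x = A *v y"
        using x y by (auto simp: basic_solutions_def feasible_set_def)
      fix j assume j: "j \<notin> {j. x $ j > 0}"
      then have "j \<notin> {j. y $ j > 0}" using eq by simp
      with j have "x $ j = 0" "y $ j = 0"
        using x y by (auto simp: basic_solutions_def feasible_set_def not_less intro: antisym)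
      then show "x $ j = y $ j" by simp
    qed
  qed
  then show ?thesis by (rule inj_on_finite[where B = UNIV]) auto
qed

text \<open>
  Room for the two-sided perturbation: a coordinate that is strictly positive stays nonnegative
  under small changes, and one step size serves all coordinates because there are finitely many.
\<close>

lemma ex_two_sided_step:
  fixes x d :: "real ^ 'n"
  assumes "\<And>j. 0 \<le> x $ j" and "\<And>j. x $ j = 0 \<Longrightarrow> d $ j = 0"
  obtains \<epsilon> where "\<epsilon> > 0" "\<And>j. \<epsilon> * \<bar>d $ j\<bar> \<le> x $ j"
proof -
  have "\<forall>\<^sub>F \<epsilon> in at_right 0. \<forall>j\<in>UNIV. \<epsilon> * \<bar>d $ j\<bar> \<le> x $ j"
  proof (rule eventually_ball_finite[OF finite], rule ballI)
    fix j
    show "\<forall>\<^sub>F \<epsilon> in at_right 0. \<epsilon> * \<bar>d $ j\<bar> \<le> x $ j"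
    proof (cases "x $ j = 0")
      case True
      then show ?thesis using assms(2) by simp
    next
      case False
      then have "0 < x $ j" using assms(1)[of j] by simp
      have "((\<lambda>\<epsilon>. \<epsilon> * \<bar>d $ j\<bar>) \<longlongrightarrow> 0 * \<bar>d $ j\<bar>) (at_right 0)"
        by (intro tendsto_intros)
      then have "((\<lambda>\<epsilon>. \<epsilon> * \<bar>d $ j\<bar>) \<longlongrightarrow> 0) (at_right 0)" by simp
      from order_tendstoD(2)[OF this \<open>0 < x $ j\<close>] show ?thesis
        by eventually_elim simp
    qed
  qed
  moreover have "\<forall>\<^sub>F \<epsilon> in at_right (0::real). 0 < \<epsilon>"
    by (rule eventually_at_right_less)
  ultimately have "\<forall>\<^sub>F \<epsilon> in at_right (0::real). 0 < \<epsilon> \<and> (\<forall>j. \<epsilon> * \<bar>d $ j\<bar> \<le> x $ j)"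
    by eventually_elim auto
  then obtain \<epsilon> where "0 < \<epsilon> \<and> (\<forall>j. \<epsilon> * \<bar>d $ j\<bar> \<le> x $ j)"
    using eventually_happens' trivial_limit_at_right_real by blast
  then show ?thesis using that by blast
qed

text \<open>
  A coordinate of \<open>x\<close> that is zero is a positive combination of the nonnegative coordinates of the
  endpoints of any segment around \<open>x\<close>, so both of these are zero. The endpoints thus solve the
  same system and agree off the support of \<open>x\<close>, which makes them equal.
\<close>

lemma basic_solution_imp_extreme_point:
  assumes "x \<in> basic_solutions A b"
  shows "x extreme_point_of feasible_set A b"
  unfolding extreme_point_of_def
proof (intro conjI ballI notI)
  show "x \<in> feasible_set A b"
    using assms by (simp add: basic_solutions_def)
  fix y z
  assume y: "y \<in> feasible_set A b" and z: "z \<in> feasible_set A b" and "x \<in> open_segment y z"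
  then obtain u where "y \<noteq> z" and u: "0 < u" "u < 1" and x: "x = (1 - u) *\<^sub>R y + u *\<^sub>R z"
    by (auto simp: in_segment)
  have "y = z"
  proof (rule independent_columns_imp_unique_solution)
    show "independent_columns A {j. x $ j > 0}" and "A *v y = A *v z"
      using assms y z by (auto simp: basic_solutions_def feasible_set_def)
    fix j assume "j \<notin> {j. x $ j > 0}"
    then have "(1 - u) * y $ j + u * z $ j \<le> 0" using x by simp
    moreover have "0 \<le> (1 - u) * y $ j" "0 \<le> u * z $ j"
      using y z u by (auto simp: feasible_set_def)
    ultimately have "(1 - u) * y $ j = 0" "u * z $ j = 0"
      by linarith+
    then show "y $ j = z $ j" using u by simp
  qed
  with \<open>y \<noteq> z\<close> show False by contradiction
qed

text \<open>
  The coefficients of a dependency among the support columns, extended by zero, form a direction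
  \<open>d\<close> with \<open>A *v d = 0\<close>. It changes only coordinates of \<open>x\<close> that are strictly positive, so a small
  step along it stays feasible in both senses and exhibits \<open>x\<close> as a midpoint.
\<close>

lemma extreme_point_imp_basic_solution:
  assumes ext: "x extreme_point_of feasible_set A b"
  shows "x \<in> basic_solutions A b"
proof -
  have x: "A *v x = b" "\<And>j. 0 \<le> x $ j"
    using ext by (auto simp: extreme_point_of_def feasible_set_def)
  let ?J = "{j. x $ j > 0}"
  have "\<forall>j\<in>?J. c j = 0" if c: "(\<Sum>j\<in>?J. c j *\<^sub>R column j A) = 0" for c
  proof (rule ccontr)
    assume "\<not> (\<forall>j\<in>?J. c j = 0)"
    then obtain i where i: "i \<in> ?J" "c i \<noteq> 0" by blast
    define d :: "real ^ 'a" where "d = (\<chi> j. if j \<in> ?J then c j else 0)"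
    have "A *v d = (\<Sum>j\<in>?J. d $ j *\<^sub>R column j A)"
      by (rule matrix_vector_mult_eq_sum_columns_on) (simp add: d_def)
    also have "\<dots> = 0" using c by (simp add: d_def)
    finally have Ad: "A *v d = 0" .
    obtain \<epsilon> where \<epsilon>: "\<epsilon> > 0" "\<And>j. \<epsilon> * \<bar>d $ j\<bar> \<le> x $ j"
      by (rule ex_two_sided_step[of x d]) (auto simp: x d_def)
    have "0 \<le> x $ j + s * d $ j" if "\<bar>s\<bar> = \<epsilon>" for s j
      using \<epsilon>(2)[of j] that abs_ge_minus_self[of "s * d $ j"] by (simp add: abs_mult)
    from this[of "\<epsilon>"] this[of "- \<epsilon>"]
    have mem: "x - \<epsilon> *\<^sub>R d \<in> feasible_set A b" "x + \<epsilon> *\<^sub>R d \<in> feasible_set A b"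
      using x Ad \<epsilon>(1)
      by (auto simp: feasible_set_def matrix_vector_mult_diff_distrib
          matrix_vector_right_distrib matrix_vector_mult_scaleR)
    have "d $ i \<noteq> 0" using i by (simp add: d_def)
    then have "d \<noteq> 0" by auto
    then have "x - \<epsilon> *\<^sub>R d \<noteq> x + \<epsilon> *\<^sub>R d"
      using \<epsilon>(1) by (auto simp: vec_eq_iff)
    then have "midpoint (x - \<epsilon> *\<^sub>R d) (x + \<epsilon> *\<^sub>R d) \<in> open_segment (x - \<epsilon> *\<^sub>R d) (x + \<epsilon> *\<^sub>R d)"
      by simp
    moreover have "midpoint (x - \<epsilon> *\<^sub>R d) (x + \<epsilon> *\<^sub>R d) = x"
      by (simp add: midpoint_def flip: scaleR_2)
    ultimately show False
      using ext mem by (auto simp: extreme_point_of_def)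
  qed
  then show ?thesis
    using x by (simp add: basic_solutions_def feasible_set_def independent_columns_iff)
qed

lemma basic_solutions_eq_extreme_points:
  "basic_solutions A b = {x. x extreme_point_of feasible_set A b}"
  using basic_solution_imp_extreme_point extreme_point_imp_basic_solution by blast

lemma convex_feasible_set: "convex (feasible_set A b)"
proof (rule convexI)
  fix x y u v
  assume x: "x \<in> feasible_set A b" and y: "y \<in> feasible_set A b"
    and uv: "0 \<le> u" "0 \<le> v" "u + v = (1::real)"
  have "u *\<^sub>R b + v *\<^sub>R b = b"
    using uv(3) by (simp flip: scaleR_left_distrib)
  with x y uv(1,2) show "u *\<^sub>R x + v *\<^sub>R y \<in> feasible_set A b"
    by (simp add: feasible_set_def matrix_vector_right_distrib matrix_vector_mult_scaleR)
qed

lemma closed_feasible_set: "closed (feasible_set A b)"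
proof -
  have "closed {x. A *v x = b}"
    by (rule closed_Collect_eq)
      (rule matrix_vector_mult_linear_continuous_on, rule continuous_on_const)
  moreover have "closed {x::real^'a. \<forall>j. 0 \<le> x $ j}"
    by (rule closed_Collect_all, rule closed_Collect_le)
      (rule continuous_on_const, rule continuous_on_component[OF continuous_on_id])
  ultimately show ?thesis
    unfolding feasible_set_def by (rule closed_Collect_conj)
qed

text \<open>
  The objective attains its maximum over the feasible set at \<open>w\<close>, so \<open>p \<bullet> x \<le> p \<bullet> w\<close> is a valid
  inequality; the optimal points are those where it is tight.
\<close>

lemma optimal_solutions_eq_hyperplane_section:
  assumes "w \<in> optimal_solutions A b p"
  shows "optimal_solutions A b p = feasible_set A b \<inter> {x. p \<bullet> x = p \<bullet> w}"
proof
  have w: "w \<in> feasible_set A b" "\<And>z. z \<in> feasible_set A b \<Longrightarrow> p \<bullet> z \<le> p \<bullet> w"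
    using assms by (auto simp: optimal_solutions_def)
  show "optimal_solutions A b p \<subseteq> feasible_set A b \<inter> {x. p \<bullet> x = p \<bullet> w}"
    using w by (auto simp: optimal_solutions_def intro: antisym)
  show "feasible_set A b \<inter> {x. p \<bullet> x = p \<bullet> w} \<subseteq> optimal_solutions A b p"
    using w by (auto simp: optimal_solutions_def)
qed

lemma optimal_solutions_face_of:
  "optimal_solutions A b p face_of feasible_set A b"
proof (cases "optimal_solutions A b p = {}")
  case True
  then show ?thesis by simp
next
  case False
  then obtain w where w: "w \<in> optimal_solutions A b p" by blast
  then have "p \<bullet> x \<le> p \<bullet> w" if "x \<in> feasible_set A b" for x
    using that by (simp add: optimal_solutions_def)
  with convex_feasible_set
  show ?thesis
    unfolding optimal_solutions_eq_hyperplane_section[OF w]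
    by (rule face_of_Int_supporting_hyperplane_le)
qed

lemma basic_optimal_solutions_eq_extreme_points:
  "basic_optimal_solutions A b p = {y. y extreme_point_of optimal_solutions A b p}"
  by (auto simp: basic_optimal_solutions_def basic_solutions_eq_extreme_points
      extreme_point_of_face[OF optimal_solutions_face_of])

lemma optimal_solutions_eq_convex_hull:
  assumes "bounded (feasible_set A b)"
  shows "optimal_solutions A b p = convex hull (basic_optimal_solutions A b p)"
proof -
  have "compact (feasible_set A b)"
    using assms closed_feasible_set by (simp add: compact_eq_bounded_closed)
  then have "compact (optimal_solutions A b p)"
    using face_of_imp_compact convex_feasible_set optimal_solutions_face_of by blast
  moreover have "convex (optimal_solutions A b p)"
    using optimal_solutions_face_of by (rule face_of_imp_convex)
  ultimately show ?thesis
    unfolding basic_optimal_solutions_eq_extreme_points by (rule Krein_Milman_Minkowski)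
qed

theorem theorem3:
  fixes A :: "real ^ 'n ^ 'm" and b :: "real ^ 'm" and p :: "real ^ 'n"
  assumes "feasible_set A b \<noteq> {}"
    and "optimal_solutions A b p \<noteq> {}"
    and "bounded (feasible_set A b)"
  shows "optimal_solutions A b p =
      {(\<Sum>y \<in> basic_optimal_solutions A b p. \<alpha> y *\<^sub>R y) | \<alpha> :: real ^ 'n \<Rightarrow> real.
        (\<forall>y \<in> basic_optimal_solutions A b p. 0 \<le> \<alpha> y) \<and>
        (\<Sum>y \<in> basic_optimal_solutions A b p. \<alpha> y) = 1}
    \<and> basic_optimal_solutions A b p = {y. y extreme_point_of (optimal_solutions A b p)}"
proof
  have "finite (basic_optimal_solutions A b p)"
    by (simp add: basic_optimal_solutions_def finite_basic_solutions)
  from convex_hull_finite[OF this]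
  show "optimal_solutions A b p =
      {(\<Sum>y \<in> basic_optimal_solutions A b p. \<alpha> y *\<^sub>R y) | \<alpha> :: real ^ 'n \<Rightarrow> real.
        (\<forall>y \<in> basic_optimal_solutions A b p. 0 \<le> \<alpha> y) \<and>
        (\<Sum>y \<in> basic_optimal_solutions A b p. \<alpha> y) = 1}"
    unfolding optimal_solutions_eq_convex_hull[OF assms(3)] by auto
qed (rule basic_optimal_solutions_eq_extreme_points)

end
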